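(* Let $t\in\mathbb{R}\setminus\mathbb{Z}_{\ge0}$ and $r>0$, and let $Q=\{q_s\}_{s\ge0}$ be a norm-continuous $\boxplus^H_t$-semigroup in $\mathcal{A}_{r,H}^{(t)}$. Then the limit $$\eta_Q=\lim_{s\downarrow0}\frac{\Phi_t^H(q_s)-1}{s}$$ exists in $\mathcal{A}_r$, and $$\Phi_t^H(q_s)=\exp(s\eta_Q),\qquad s\ge0.$$ The infinitesimal generator $L_{r,H}^{(t)}[Q]$ of the convolution operator semigroup $T_sf=f\boxplus^H_tq_s$ on $\mathcal{A}_{r,H}^{(t)}$ is the bounded operator $$L_{r,H}^{(t)}[Q]=(\Phi_t^H)^{-1}\circ M_{\eta_Q}\circ\Phi_t^H,$$ where $M_{\eta_Q}F=\eta_QF$ for $F\in\mathcal{A}_r$. Equivalently, $$L_{r,H}^{(t)}[Q]f=\lim_{s\downarrow0}\frac{f\boxplus^H_tq_s-f}{s}\quad\text{for every }f\in\mathcal{A}_{r,H}^{(t)}$$ (limit in $\|\cdot\|_{r,t}$).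
   Context: $\mathbb{N}=\{0,1,2,\dots\}$. $H\mathbb{R}$ is the set of all maps $f:\mathbb{N}\to\mathbb{R}$. $(t)_{\underline{0}}=1$, $(t)_{\underline{n}}=t(t-1)\cdots(t-n+1)$ for $n\ge1$. $(f\boxplus^H_tg)(n)=\sum_{i+j=n}\frac{(t)_{\underline{n}}}{(t)_{\underline{i}}(t)_{\underline{j}}}f(i)g(j)$. $h_1\in H\mathbb{R}$ is given by $h_1(0)=1$, $h_1(m)=0$ for $m\ne0$. $\Phi_t^H(f)(z)=\sum_{n\ge0}\frac{f(n)}{(t)_{\underline{n}}}z^n$. $\mathcal{A}_{r,H}^{(t)}=\{f\in H\mathbb{R}:\|f\|_{r,t}:=\sum_{n\ge0}|f(n)/(t)_{\underline{n}}|\,r^n<\infty\}$, and $\mathcal{A}_r=\{F(z)=\sum_{n\ge0}a_nz^n\ (a_n\in\mathbb{R}):\|F\|_r:=\sum_{n\ge0}|a_n|r^n<\infty\}$, the latter with the Cauchy product (a unital commutative Banach algebra); $\exp$ is the exponential in this Banach algebra. $\Phi_t^H$ maps $\mathcal{A}_{r,H}^{(t)}$ onto $\mathcal{A}_r$ bijectively. A norm-continuous $\boxplus^H_t$-semigroup in $\mathcal{A}_{r,H}^{(t)}$ is a family $\{q_s\}_{s\ge0}\subset\mathcal{A}_{r,H}^{(t)}$ with $q_0=h_1$, $q_{s+u}=q_s\boxplus^H_tq_u$ for all $s,u\ge0$, and $\|q_s-h_1\|_{r,t}\to0$ as $s\downarrow0$. *)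

theory Defs
  imports "HOL-Analysis.Analysis"
begin

definition falling :: "real \<Rightarrow> nat \<Rightarrow> real" where
  "falling t n = (\<Prod>k<n. t - real k)"

definition conv_H :: "real \<Rightarrow> (nat \<Rightarrow> real) \<Rightarrow> (nat \<Rightarrow> real) \<Rightarrow> nat \<Rightarrow> real" where
  "conv_H t f g n = (\<Sum>i\<le>n. falling t n / (falling t i * falling t (n - i)) * f i * g (n - i))"

definition h1 :: "nat \<Rightarrow> real" where
  "h1 m = (if m = 0 then 1 else 0)"

definition Phi_H :: "real \<Rightarrow> (nat \<Rightarrow> real) \<Rightarrow> real fps" where
  "Phi_H t f = Abs_fps (\<lambda>n. f n / falling t n)"

text \<open>
  The norms below are infinite sums of nonnegative terms; they are meaningful
  only on the carriers \<open>A_H r t\<close> and \<open>A_fps r\<close>, where the series converge.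
  The Cauchy product and the unit of \<open>A_fps r\<close> are those of the type of formal power series.
\<close>

definition norm_H :: "real \<Rightarrow> real \<Rightarrow> (nat \<Rightarrow> real) \<Rightarrow> real" where
  "norm_H r t f = (\<Sum>n. \<bar>f n / falling t n\<bar> * r ^ n)"

definition A_H :: "real \<Rightarrow> real \<Rightarrow> (nat \<Rightarrow> real) set" where
  "A_H r t = {f. summable (\<lambda>n. \<bar>f n / falling t n\<bar> * r ^ n)}"

definition norm_fps :: "real \<Rightarrow> real fps \<Rightarrow> real" where
  "norm_fps r F = (\<Sum>n. \<bar>fps_nth F n\<bar> * r ^ n)"

definition A_fps :: "real \<Rightarrow> real fps set" where
  "A_fps r = {F. summable (\<lambda>n. \<bar>fps_nth F n\<bar> * r ^ n)}"

text \<open>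
  Convergence with respect to the norm \<open>N\<close> on the carrier \<open>A\<close>. Eventual membership in
  \<open>A\<close> is part of the notion, since \<open>N\<close> is meaningless outside \<open>A\<close>. In particular, limits of
  formal power series are not taken in the topology that the library puts on their type.
\<close>

definition norm_tendsto ::
  "'a::minus set \<Rightarrow> ('a \<Rightarrow> real) \<Rightarrow> ('i \<Rightarrow> 'a) \<Rightarrow> 'a \<Rightarrow> 'i filter \<Rightarrow> bool" where
  "norm_tendsto A N X l F \<longleftrightarrow>
     l \<in> A \<and> (\<forall>\<^sub>F i in F. X i \<in> A) \<and> ((\<lambda>i. N (X i - l)) \<longlongrightarrow> 0) F"

text \<open>The sum of the exponential series of \<open>F\<close> in the Banach algebra \<open>A_fps r\<close>.\<close>

definition exp_fps_in :: "real \<Rightarrow> real fps \<Rightarrow> real fps" where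
  "exp_fps_in r F =
     (THE G. norm_tendsto (A_fps r) (norm_fps r)
        (\<lambda>n. \<Sum>k<n. fps_const (1 / fact k) * F ^ k) G sequentially)"

definition norm_cont_semigroup_H :: "real \<Rightarrow> real \<Rightarrow> (real \<Rightarrow> nat \<Rightarrow> real) \<Rightarrow> bool" where
  "norm_cont_semigroup_H r t q \<longleftrightarrow>
     (\<forall>s\<ge>0. q s \<in> A_H r t) \<and>
     q 0 = h1 \<and>
     (\<forall>s\<ge>0. \<forall>u\<ge>0. q (s + u) = conv_H t (q s) (q u)) \<and>
     ((\<lambda>s. norm_H r t (q s - h1)) \<longlongrightarrow> 0) (at_right 0)"

text \<open>
  Operators on the space \<open>A_H r t\<close> are functions on all sequences of which only the
  restriction to \<open>A_H r t\<close> is relevant.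
\<close>

definition bounded_operator_H ::
  "real \<Rightarrow> real \<Rightarrow> ((nat \<Rightarrow> real) \<Rightarrow> nat \<Rightarrow> real) \<Rightarrow> bool" where
  "bounded_operator_H r t T \<longleftrightarrow>
     (\<forall>f\<in>A_H r t. T f \<in> A_H r t) \<and>
     (\<forall>f\<in>A_H r t. \<forall>g\<in>A_H r t. T (\<lambda>n. f n + g n) = (\<lambda>n. T f n + T g n)) \<and>
     (\<forall>c. \<forall>f\<in>A_H r t. T (\<lambda>n. c * f n) = (\<lambda>n. c * T f n)) \<and>
     (\<exists>C. \<forall>f\<in>A_H r t. norm_H r t (T f) \<le> C * norm_H r t f)"

text \<open>Strongly continuous one-parameter semigroups of bounded operators on \<open>A_H r t\<close>.\<close>

definition operator_semigroup_H ::
  "real \<Rightarrow> real \<Rightarrow> (real \<Rightarrow> (nat \<Rightarrow> real) \<Rightarrow> nat \<Rightarrow> real) \<Rightarrow> bool" where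
  "operator_semigroup_H r t T \<longleftrightarrow>
     (\<forall>s\<ge>0. bounded_operator_H r t (T s)) \<and>
     (\<forall>f\<in>A_H r t. T 0 f = f) \<and>
     (\<forall>s\<ge>0. \<forall>u\<ge>0. \<forall>f\<in>A_H r t. T (s + u) f = T s (T u f)) \<and>
     (\<forall>f\<in>A_H r t. norm_tendsto (A_H r t) (norm_H r t) (\<lambda>s. T s f) f (at_right 0))"

definition generator_lim_H ::
  "real \<Rightarrow> real \<Rightarrow> (real \<Rightarrow> (nat \<Rightarrow> real) \<Rightarrow> nat \<Rightarrow> real) \<Rightarrow> (nat \<Rightarrow> real) \<Rightarrow> (nat \<Rightarrow> real) \<Rightarrow> bool"
  where
  "generator_lim_H r t T f g \<longleftrightarrow>
     norm_tendsto (A_H r t) (norm_H r t) (\<lambda>s n. (T s f n - f n) / s) g (at_right 0)"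

text \<open>
  The infinitesimal generator is a priori only a partially defined operator: its domain
  consists of those \<open>f\<close> for which the difference quotients converge in norm.
\<close>

definition generator_dom_H ::
  "real \<Rightarrow> real \<Rightarrow> (real \<Rightarrow> (nat \<Rightarrow> real) \<Rightarrow> nat \<Rightarrow> real) \<Rightarrow> (nat \<Rightarrow> real) set" where
  "generator_dom_H r t T = {f \<in> A_H r t. \<exists>g. generator_lim_H r t T f g}"

definition generator_H ::
  "real \<Rightarrow> real \<Rightarrow> (real \<Rightarrow> (nat \<Rightarrow> real) \<Rightarrow> nat \<Rightarrow> real) \<Rightarrow> (nat \<Rightarrow> real) \<Rightarrow> nat \<Rightarrow> real" where
  "generator_H r t T f = (THE g. generator_lim_H r t T f g)"

definition conv_operator_H ::
  "real \<Rightarrow> (real \<Rightarrow> nat \<Rightarrow> real) \<Rightarrow> real \<Rightarrow> (nat \<Rightarrow> real) \<Rightarrow> nat \<Rightarrow> real" where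
  "conv_operator_H t q s f = conv_H t f (q s)"

definition mult_operator :: "real fps \<Rightarrow> real fps \<Rightarrow> real fps" where
  "mult_operator \<eta> F = \<eta> * F"

end

theory Submission
  imports Defs
begin

text \<open>
  After transport by \<open>Phi_H\<close>, the family \<open>q\<close> is a norm-continuous one-parameter semigroup \<open>P\<close>
  in a unital Banach algebra. With \<open>V = \<integral>\<^sub>0\<^sup>a P\<close>, the semigroup law gives
  \<open>P s * V = \<integral>\<^sub>s\<^sup>s\<^sup>+\<^sup>a P\<close>. For small \<open>a\<close> the element \<open>V / a\<close> is close to \<open>1\<close>, hence
  \<open>V\<close> is invertible and \<open>P\<close> is differentiable with \<open>P' = P A\<close> for a constant \<open>A\<close>; then
  \<open>P s exp (- s A)\<close> is constant. Since \<open>Phi_H\<close> turns the convolution into the Cauchy product,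
  the generator becomes multiplication by \<open>A\<close>.
\<close>

section \<open>Norm-continuous semigroups in Banach algebras\<close>

text \<open>The Neumann series \<open>S\<close> of \<open>1 - x\<close> satisfies
  \<open>S = 1 + (1 - x) * S\<close>, which rearranges to \<open>x * S = 1\<close>. A right inverse
  is the side needed later to cancel \<open>W a\<close> in \<open>P s * W a\<close>.\<close>

lemma right_inverse_near_one:
  fixes x :: "'a::{real_normed_algebra_1, banach}"
  assumes "norm (1 - x) < 1"
  shows "\<exists>y. x * y = 1"
proof -
  let ?z = "1 - x"
  have "summable (\<lambda>n. ?z ^ n)"
    using assms by (rule complete_algebra_summable_geometric)
  then have "(\<Sum>n. ?z ^ n) = 1 + ?z * (\<Sum>n. ?z ^ n)"
    using suminf_split_head[of "\<lambda>n. ?z ^ n"] suminf_mult[of "\<lambda>n. ?z ^ n" ?z]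
    by simp
  then have "x * (\<Sum>n. ?z ^ n) = 1"
    by (simp add: left_diff_distrib algebra_simps)
  then show ?thesis ..
qed

text \<open>Norms are at most 2 on a short interval \<open>[0, d)\<close>, and a point below
  \<open>n * d\<close> splits into \<open>n\<close> steps shorter than \<open>d\<close>, so
  submultiplicativity gives the bound \<open>2 ^ n\<close>.\<close>

lemma semigroup_locally_bounded:
  fixes P :: "real \<Rightarrow> 'a::real_normed_algebra_1"
  assumes "P 0 = 1" and add: "\<And>s u. s \<ge> 0 \<Longrightarrow> u \<ge> 0 \<Longrightarrow> P (s + u) = P s * P u"
    and lim: "(P \<longlongrightarrow> 1) (at_right 0)"
  shows "\<exists>B>0. \<forall>s\<in>{0..b}. norm (P s) \<le> B"
proof -
  have "\<forall>\<^sub>F s in at_right 0. norm (P s - 1) < 1"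
    using tendstoD[OF lim, of 1] by (simp add: dist_norm)
  then obtain d where d: "d > 0" "\<And>s. 0 < s \<Longrightarrow> s < d \<Longrightarrow> norm (P s - 1) < 1"
    unfolding eventually_at_right_field by auto
  have le2: "norm (P s) \<le> 2" if "0 \<le> s" "s < d" for s
  proof (cases "s = 0")
    case False
    with that d(2)[of s] norm_triangle_ineq[of "P s - 1" 1] show ?thesis by simp
  qed (simp add: \<open>P 0 = 1\<close>)
  have bound: "norm (P s) \<le> 2 ^ n" if "0 \<le> s" "s < real n * d" for n s
    using that
  proof (induction n arbitrary: s)
    case (Suc n)
    show ?case
    proof (cases "s < d")
      case True
      have "(2 :: real) \<le> 2 ^ Suc n" by simp
      with True Suc.prems(1) le2[of s] show ?thesis by (metis order_trans)
    next
      case False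
      \<comment> \<open>Since \<open>d <= s < Suc n * d\<close>, the case \<open>n = 0\<close> is
        excluded; this keeps \<open>s - h < n * d\<close> strict for the equal step
        \<open>h\<close>.\<close>
      then have n: "0 < n" using Suc.prems by (cases n) auto
      define h where "h = s / real (Suc n)"
      have h: "0 \<le> h" "h < d" "0 \<le> s - h" "s - h < real n * d"
      proof -
        have "s = real (Suc n) * h" by (simp add: h_def)
        then have eq: "s - h = real n * h" by (simp add: algebra_simps)
        show "0 \<le> h" using Suc.prems(1) by (simp add: h_def)
        show "h < d" using Suc.prems(2) by (simp add: h_def divide_less_eq mult.commute)
        show "0 \<le> s - h" "s - h < real n * d"
          unfolding eq using \<open>0 \<le> h\<close> \<open>h < d\<close> n by simp_all
      qed
      have "norm (P s) \<le> norm (P (s - h)) * norm (P h)"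
        using add[of "s - h" h] h norm_mult_ineq[of "P (s - h)" "P h"] by simp
      also have "\<dots> \<le> 2 ^ n * 2"
        using Suc.IH[of "s - h"] le2[of h] h by (intro mult_mono) auto
      finally show ?thesis by simp
    qed
  qed simp
  obtain n where "b < real n * d"
    using d(1) reals_Archimedean3 by blast
  with bound[of _ n] show ?thesis
    by (intro exI[of _ "2 ^ n"]) auto
qed

text \<open>The identity \<open>P v - P u = P u * (P (v - u) - 1)\<close>, with the smaller point
  \<open>u\<close> as base, reduces continuity from both sides to the right limit at 0; the local
  bound on \<open>P u\<close> makes \<open>d\<close> independent of the base point.\<close>

lemma semigroup_continuous_on:
  fixes P :: "real \<Rightarrow> 'a::real_normed_algebra_1"
  assumes "P 0 = 1" and add: "\<And>s u. s \<ge> 0 \<Longrightarrow> u \<ge> 0 \<Longrightarrow> P (s + u) = P s * P u"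
    and lim: "(P \<longlongrightarrow> 1) (at_right 0)"
  shows "continuous_on {0..b} P"
  unfolding continuous_on_iff
proof (intro ballI allI impI)
  fix x e :: real
  assume x: "x \<in> {0..b}" and e: "e > 0"
  obtain B where B: "B > 0" "\<And>s. s \<in> {0..b} \<Longrightarrow> norm (P s) \<le> B"
    using semigroup_locally_bounded[OF assms] by blast
  have "\<forall>\<^sub>F s in at_right 0. norm (P s - 1) < e / B"
    using tendstoD[OF lim, of "e / B"] e B(1) by (simp add: dist_norm)
  then obtain d where d: "d > 0" "\<And>s. 0 < s \<Longrightarrow> s < d \<Longrightarrow> norm (P s - 1) < e / B"
    unfolding eventually_at_right_field by auto
  have step: "norm (P v - P u) < e" if "u \<in> {0..b}" "u < v" "v - u < d" for u v
  proof -
    have "P v - P u = P u * (P (v - u) - 1)"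
      using add[of u "v - u"] that by (simp add: algebra_simps)
    then have "norm (P v - P u) \<le> norm (P u) * norm (P (v - u) - 1)"
      by (simp add: norm_mult_ineq)
    also have "\<dots> \<le> B * norm (P (v - u) - 1)"
      using B(2)[OF that(1)] by (simp add: mult_right_mono)
    also have "\<dots> < e"
      using d(2)[of "v - u"] that B(1) by (simp add: field_simps)
    finally show ?thesis .
  qed
  have "dist (P x') (P x) < e" if "x' \<in> {0..b}" "dist x' x < d" for x'
    using step[of x x'] step[of x' x] that x e
    by (cases x' x rule: linorder_cases) (auto simp: dist_norm norm_minus_commute)
  with d(1) show "\<exists>d>0. \<forall>x'\<in>{0..b}. dist x' x < d \<longrightarrow> dist (P x') (P x) < e" by blast
qed

theorem norm_continuous_semigroup_eq_exp:
  fixes P :: "real \<Rightarrow> 'a::{real_normed_algebra_1, banach}"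
  assumes "P 0 = 1" and add: "\<And>s u. s \<ge> 0 \<Longrightarrow> u \<ge> 0 \<Longrightarrow> P (s + u) = P s * P u"
    and lim: "(P \<longlongrightarrow> 1) (at_right 0)"
  shows "\<exists>A. \<forall>s\<ge>0. P s = exp (s *\<^sub>R A)"
proof -
  have cont: "continuous_on {0..b} P" for b
    using semigroup_continuous_on[OF assms] .
  have int: "P integrable_on {0..b}" for b
    using cont integrable_continuous_real by blast
  define W where "W s = integral {0..s} P" for s
  have W: "(W has_vector_derivative P s) (at s within {0..b})" if "s \<in> {0..b}" for s b
    using integral_has_vector_derivative[OF cont that] by (simp add: W_def[abs_def])
  have "\<forall>\<^sub>F s in at_right 0. norm (P s - 1) < 1 / 2"
    using tendstoD[OF lim, of "1 / 2"] by (simp add: dist_norm)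
  then obtain d where d: "d > 0" "\<And>s. 0 < s \<Longrightarrow> s < d \<Longrightarrow> norm (P s - 1) < 1 / 2"
    unfolding eventually_at_right_field by auto
  \<comment> \<open>Halving \<open>d\<close> puts the closed interval \<open>{0..a}\<close> inside
    the region of the estimate; the point 0 is covered by \<open>P 0 = 1\<close>.\<close>
  define a where "a = d / 2"
  have a: "a > 0" and near1: "\<And>s. s \<in> {0..a} \<Longrightarrow> norm (1 - P s) \<le> 1 / 2"
    using d \<open>P 0 = 1\<close> by (auto simp: a_def order.order_iff_strict norm_minus_commute)
  \<comment> \<open>\<open>Z\<close> is the mean of \<open>1 - P s\<close> over
    \<open>{0..a}\<close>, so its norm is at most 1/2.\<close>
  define Z where "Z = 1 - W a /\<^sub>R a"
  have "norm (integral {0..a} (\<lambda>s. 1 - P s)) \<le> 1 / 2 * (a - 0)"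
    using a near1 by (intro integral_bound continuous_intros cont) auto
  moreover have "integral {0..a} (\<lambda>s. 1 - P s) = a *\<^sub>R Z"
    using a Henstock_Kurzweil_Integration.integral_diff[OF integrable_const_ivl[of 1 0 a] int[of a]]
    by (simp add: Z_def W_def scaleR_diff_right)
  ultimately have "norm Z < 1"
    using a by simp
  then obtain Y0 where "(W a /\<^sub>R a) * Y0 = 1"
    using right_inverse_near_one[of "W a /\<^sub>R a"] unfolding Z_def by auto
  then obtain Y where Y: "W a * Y = 1"
    using that[of "Y0 /\<^sub>R a"] by simp
  have PV: "P s * W a = W (s + a) - W s" if "s \<ge> 0" for s
  proof -
    have "P s * W a = integral {0..a} (\<lambda>u. P s * P u)"
      using integral_linear[OF int bounded_linear_mult_right[of "P s"], of a]
      by (simp add: W_def o_def)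
    also have "\<dots> = integral {0..a} (\<lambda>u. P (s + u))"
      using that by (intro integral_cong) (simp add: add)
    also have "\<dots> = integral {s..s + a} P"
      using integral_shift_Icc_real[of 0 a P s] by (simp add: o_def add.commute)
    also have "\<dots> = W (s + a) - W s"
      using Henstock_Kurzweil_Integration.integral_combine[OF that _ int[of "s + a"]] a by (simp add: W_def algebra_simps)
    finally show ?thesis .
  qed
  \<comment> \<open>The value is read off from
    \<open>P' s = (P (s + a) - P s) * Y = P s * (P a - 1) * Y\<close>, the derivative of the formula
    for \<open>P s\<close> below.\<close>
  define A where "A = (P a - 1) * Y"
  \<comment> \<open>Cancelling \<open>W a\<close> by its right inverse writes the merely continuous
    \<open>P\<close> through its antiderivative, hence as a differentiable function.\<close>
  have P_eq: "P s = (W (s + a) - W s) * Y" if "s \<ge> 0" for s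
    using PV[OF that] Y by (metis mult.assoc mult.right_neutral)
  have deriv: "(P has_vector_derivative P s * A) (at s within {0..b})" if s: "s \<in> {0..b}" for s b
  proof -
    have "((\<lambda>s. W (s + a)) has_vector_derivative P (s + a)) (at s within {0..b})"
    proof -
      have "(W has_vector_derivative P (s + a)) (at (s + a) within (\<lambda>s. s + a) ` {0..b})"
        by (rule has_vector_derivative_within_subset[OF W[of "s + a" "b + a"]]) (use s a in auto)
      moreover have "((\<lambda>s. s + a) has_vector_derivative 1) (at s within {0..b})"
        by (auto intro!: derivative_eq_intros)
      ultimately show ?thesis
        using vector_diff_chain_within[of "\<lambda>s. s + a" 1 s "{0..b}" W "P (s + a)"]
        by (simp add: o_def)
    qed
    then have "((\<lambda>s. (W (s + a) - W s) * Y) has_vector_derivative (P (s + a) - P s) * Y)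
        (at s within {0..b})"
      by (intro derivative_intros W s)
    moreover have "(P (s + a) - P s) * Y = P s * A"
      using s a add[of s a] by (simp add: A_def algebra_simps)
    ultimately show ?thesis
      using s by (auto intro: has_vector_derivative_transform[OF s] simp: P_eq)
  qed
  have "P b = exp (b *\<^sub>R A)" if "b \<ge> 0" for b
  proof -
    have "((\<lambda>s. P s * exp (s *\<^sub>R (- A))) has_derivative (\<lambda>h. 0)) (at s within {0..b})"
      if s: "s \<in> {0..b}" for s
    proof -
      \<comment> \<open>With \<open>A\<close> to the left of the exponential, the two product-rule
        terms cancel by associativity alone, without commutativity.\<close>
      have "((\<lambda>s. P s * exp (s *\<^sub>R (- A))) has_vector_derivative
          P s * (- A * exp (s *\<^sub>R (- A))) + P s * A * exp (s *\<^sub>R (- A))) (at s within {0..b})"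
        by (intro derivative_intros deriv[OF s]
            has_vector_derivative_at_within[OF exp_scaleR_has_vector_derivative_left])
      then show ?thesis
        by (simp add: has_vector_derivative_def mult.assoc)
    qed
    then have "P b * exp (b *\<^sub>R (- A)) = P 0 * exp (0 *\<^sub>R (- A))"
      using that
      by (intro has_derivative_zero_unique[of "{0..b}" "\<lambda>s. P s * exp (s *\<^sub>R (- A))"]) auto
    then have "P b * exp (- (b *\<^sub>R A)) = 1"
      by (simp add: \<open>P 0 = 1\<close>)
    then have "P b * exp (- (b *\<^sub>R A)) * exp (b *\<^sub>R A) = exp (b *\<^sub>R A)"
      by simp
    then show ?thesis
      using exp_minus_inverse[of "- (b *\<^sub>R A)"] by (simp add: mult.assoc)
  qed
  then show ?thesis by blast
qed

text \<open>This is the derivative of the exponential curve at 0, restricted to the right side,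
  where \<open>norm s = s\<close>.\<close>

lemma exp_scaleR_diff_quotient:
  fixes A :: "'a::{real_normed_algebra_1, banach}"
  shows "((\<lambda>s. (exp (s *\<^sub>R A) - 1) /\<^sub>R s) \<longlongrightarrow> A) (at_right 0)"
proof -
  have "((\<lambda>s. exp (s *\<^sub>R A)) has_vector_derivative A) (at 0 within {0<..})"
    using exp_scaleR_has_vector_derivative_left[of A 0] has_vector_derivative_at_within by fastforce
  then have "((\<lambda>s. (1 / norm s) *\<^sub>R (exp (s *\<^sub>R A) - (1 + s *\<^sub>R A))) \<longlongrightarrow> 0) (at_right 0)"
    by (simp add: has_vector_derivative_def has_derivative_within)
  moreover have "\<forall>\<^sub>F s in at_right 0.
      (1 / norm s) *\<^sub>R (exp (s *\<^sub>R A) - (1 + s *\<^sub>R A)) = (exp (s *\<^sub>R A) - 1) /\<^sub>R s - A"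
    using eventually_at_right_less[of 0]
    by eventually_elim (simp add: algebra_simps divide_inverse)
  ultimately have "((\<lambda>s. (exp (s *\<^sub>R A) - 1) /\<^sub>R s - A) \<longlongrightarrow> 0) (at_right 0)"
    by (rule Lim_transform_eventually)
  then show ?thesis by (rule LIM_zero_cancel)
qed

section \<open>The Banach algebra of absolutely summable power series\<close>

text \<open>The preceding results are stated over type classes, so the algebra has to be a type;
  absolute summability of the coefficients is membership in \<open>A_fps 1\<close>. As a subtype of
  the formal power series it inherits the ring laws by transfer.\<close>

typedef ell1 = "{F :: real fps. summable (\<lambda>n. \<bar>fps_nth F n\<bar>)}"
  by (rule exI[of _ 0]) simp

setup_lifting type_definition_ell1

lemma abs_fps_mult_nth_le:
  "\<bar>fps_nth (F * G) n\<bar> \<le> (\<Sum>i\<le>n. \<bar>fps_nth F i\<bar> * \<bar>fps_nth G (n - i)\<bar>)" for F G :: "real fps"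
  unfolding fps_mult_nth atLeast0AtMost abs_mult[symmetric] by (rule sum_abs)

text \<open>The absolute coefficients of the product are dominated by the Cauchy product of the two
  absolute series, whose sum is the product of their sums.\<close>

lemma summable_abs_fps_mult:
  fixes F G :: "real fps"
  assumes "summable (\<lambda>n. \<bar>fps_nth F n\<bar>)" "summable (\<lambda>n. \<bar>fps_nth G n\<bar>)"
  shows "summable (\<lambda>n. \<bar>fps_nth (F * G) n\<bar>)"
    and "(\<Sum>n. \<bar>fps_nth (F * G) n\<bar>) \<le> (\<Sum>n. \<bar>fps_nth F n\<bar>) * (\<Sum>n. \<bar>fps_nth G n\<bar>)"
proof -
  have sm: "(\<lambda>n. \<Sum>i\<le>n. \<bar>fps_nth F i\<bar> * \<bar>fps_nth G (n - i)\<bar>) sums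
      ((\<Sum>n. \<bar>fps_nth F n\<bar>) * (\<Sum>n. \<bar>fps_nth G n\<bar>))"
    by (rule Cauchy_product_sums) (use assms in simp_all)
  show s: "summable (\<lambda>n. \<bar>fps_nth (F * G) n\<bar>)"
    by (rule summable_comparison_test'[OF sums_summable[OF sm], of 0]) (simp add: abs_fps_mult_nth_le)
  then show "(\<Sum>n. \<bar>fps_nth (F * G) n\<bar>) \<le> (\<Sum>n. \<bar>fps_nth F n\<bar>) * (\<Sum>n. \<bar>fps_nth G n\<bar>)"
    using suminf_le[OF abs_fps_mult_nth_le s sums_summable[OF sm]] sums_unique[OF sm] by simp
qed

lemma summable_abs_add: "summable (\<lambda>n. \<bar>f n + g n\<bar>)"
  if "summable (\<lambda>n. \<bar>f n\<bar>)" "summable (\<lambda>n. \<bar>g n\<bar>)" for f g :: "nat \<Rightarrow> real"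
  by (rule summable_comparison_test'[OF summable_add[OF that], of 0]) simp

lemma summable_abs_unit: "summable (\<lambda>n. \<bar>fps_nth (1 :: real fps) n\<bar>)"
  by (rule summable_finite[of "{0}"]) auto

instantiation ell1 :: comm_ring_1
begin

lift_definition zero_ell1 :: ell1 is 0 by simp
lift_definition one_ell1 :: ell1 is 1 by (rule summable_abs_unit)
lift_definition plus_ell1 :: "ell1 \<Rightarrow> ell1 \<Rightarrow> ell1" is "(+)" by (simp add: summable_abs_add)
lift_definition uminus_ell1 :: "ell1 \<Rightarrow> ell1" is uminus by simp
lift_definition minus_ell1 :: "ell1 \<Rightarrow> ell1 \<Rightarrow> ell1" is "(-)"
  subgoal for F G using summable_abs_add[of "fps_nth F" "\<lambda>n. - fps_nth G n"] by simp
  done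
lift_definition times_ell1 :: "ell1 \<Rightarrow> ell1 \<Rightarrow> ell1" is "(*)" by (rule summable_abs_fps_mult)

instance
  by standard (transfer; simp add: algebra_simps)+

end

instantiation ell1 :: real_vector
begin

lift_definition scaleR_ell1 :: "real \<Rightarrow> ell1 \<Rightarrow> ell1" is "\<lambda>c F. fps_const c * F"
  by (simp add: abs_mult summable_mult)

instance
  by standard (transfer; simp add: fps_eq_iff algebra_simps)+

end

instantiation ell1 :: real_normed_algebra_1
begin

lift_definition norm_ell1 :: "ell1 \<Rightarrow> real" is "\<lambda>F. \<Sum>n. \<bar>fps_nth F n\<bar>" .
definition sgn_ell1 :: "ell1 \<Rightarrow> ell1" where "sgn_ell1 x = x /\<^sub>R norm x"
definition dist_ell1 :: "ell1 \<Rightarrow> ell1 \<Rightarrow> real" where "dist_ell1 x y = norm (x - y)"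
definition uniformity_ell1 :: "(ell1 \<times> ell1) filter"
  where "uniformity_ell1 = (INF e\<in>{0<..}. principal {(x, y). dist x y < e})"
definition open_ell1 :: "ell1 set \<Rightarrow> bool"
  where "open_ell1 S \<longleftrightarrow> (\<forall>x\<in>S. \<forall>\<^sub>F (x', y) in uniformity. x' = x \<longrightarrow> y \<in> S)"

instance
proof
  fix a b :: real and x y :: ell1
  show "a *\<^sub>R x * y = a *\<^sub>R (x * y)" by transfer (simp add: mult.assoc)
  show "x * a *\<^sub>R y = a *\<^sub>R (x * y)" by transfer (simp add: mult.left_commute)
  show "norm x = 0 \<longleftrightarrow> x = 0"
    by transfer (simp add: suminf_eq_zero_iff fps_eq_iff)
  show "norm (x + y) \<le> norm x + norm y"
    by transfer (simp add: suminf_add summable_abs_add summable_add suminf_le)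
  show "norm (a *\<^sub>R x) = \<bar>a\<bar> * norm x"
    by transfer (simp add: abs_mult suminf_mult)
  show "norm (x * y) \<le> norm x * norm y"
    by transfer (rule summable_abs_fps_mult)
  show "norm (1 :: ell1) = 1"
  proof transfer
    show "(\<Sum>n. \<bar>fps_nth (1 :: real fps) n\<bar>) = 1"
      using suminf_finite[of "{0}" "\<lambda>n. \<bar>fps_nth (1 :: real fps) n\<bar>"] by simp
  qed
qed (simp_all add: sgn_ell1_def dist_ell1_def uniformity_ell1_def open_ell1_def)

end

lemma abs_coeff_le_norm_ell1: "\<bar>fps_nth (Rep_ell1 x) n\<bar> \<le> norm x"
  by transfer (use sum_le_suminf[where I = "{n}" for n] in force)

text \<open>The coefficients of a Cauchy sequence converge one by one, each being dominated by the
  norm; bounds uniform over the partial sums then turn this into norm convergence.\<close>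

instance ell1 :: banach
proof
  fix X :: "nat \<Rightarrow> ell1"
  assume X: "Cauchy X"
  define c where "c k n = fps_nth (Rep_ell1 (X k)) n" for k n
  have partial: "(\<Sum>n<m. \<bar>c j n - c k n\<bar>) \<le> norm (X j - X k)" for j k m
  proof -
    have "(\<Sum>n<m. \<bar>c j n - c k n\<bar>) \<le> (\<Sum>n. \<bar>fps_nth (Rep_ell1 (X j - X k)) n\<bar>)"
      using Rep_ell1[of "X j - X k"]
      by (auto simp: c_def minus_ell1.rep_eq intro!: sum_le_suminf)
    then show ?thesis by (simp add: norm_ell1.rep_eq)
  qed
  have "\<exists>l. (\<lambda>k. c k n) \<longlonglongrightarrow> l" for n
  proof -
    have "Cauchy (\<lambda>k. c k n)"
      unfolding Cauchy_altdef
    proof (intro allI impI)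
      fix e :: real assume "e > 0"
      then obtain M where M: "\<And>j k. j \<ge> M \<Longrightarrow> k \<ge> M \<Longrightarrow> norm (X j - X k) < e"
        using X CauchyD by blast
      have "dist (c j n) (c k n) < e" if "j \<ge> M" "k > j" for j k
        using M[of j k] abs_coeff_le_norm_ell1[of "X j - X k" n] that
        by (simp add: c_def dist_real_def minus_ell1.rep_eq)
      then show "\<exists>M. \<forall>j\<ge>M. \<forall>k>j. dist (c j n) (c k n) < e" by blast
    qed
    then show ?thesis by (simp add: Cauchy_convergent_iff convergent_def)
  qed
  then obtain l where l: "\<And>n. (\<lambda>k. c k n) \<longlonglongrightarrow> l n" by metis
  have tail: "summable (\<lambda>n. \<bar>c j n - l n\<bar>) \<and> (\<Sum>n. \<bar>c j n - l n\<bar>) \<le> e"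
    if M: "\<And>k. k \<ge> j \<Longrightarrow> norm (X j - X k) < e" for j e
  proof -
    \<comment> \<open>The limit in \<open>k\<close> is taken in a finite partial sum, where it
      commutes with the sum; the bound \<open>e\<close> does not depend on \<open>m\<close>, so
      \<open>m\<close> may then grow.\<close>
    have le: "(\<Sum>n<m. \<bar>c j n - l n\<bar>) \<le> e" for m
    proof (rule LIMSEQ_le_const2)
      show "(\<lambda>k. \<Sum>n<m. \<bar>c j n - c k n\<bar>) \<longlonglongrightarrow> (\<Sum>n<m. \<bar>c j n - l n\<bar>)"
        by (intro tendsto_intros l)
      show "\<exists>N. \<forall>k\<ge>N. (\<Sum>n<m. \<bar>c j n - c k n\<bar>) \<le> e"
        using partial[of j _ m] M by (meson less_imp_le order_trans)
    qed
    have "summable (\<lambda>n. \<bar>c j n - l n\<bar>)"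
      by (rule summableI_nonneg_bounded[OF _ le]) simp
    with le show ?thesis by (auto intro: suminf_le_const)
  qed
  have ex: "\<exists>M. \<forall>j\<ge>M. \<forall>k\<ge>M. norm (X j - X k) < e" if "e > 0" for e
    using X CauchyD that by blast
  \<comment> \<open>Tolerance 1 is enough to place the limit in the space, as a summable sequence
    plus a summable difference.\<close>
  obtain M where M: "\<And>j k. j \<ge> M \<Longrightarrow> k \<ge> M \<Longrightarrow> norm (X j - X k) < 1"
    using ex[of 1] by auto
  have "summable (\<lambda>n. \<bar>c M n\<bar>)"
    using Rep_ell1[of "X M"] by (simp add: c_def)
  moreover have "summable (\<lambda>n. \<bar>l n - c M n\<bar>)"
    using tail[of M 1] M by (simp add: abs_minus_commute)
  ultimately have "summable (\<lambda>n. \<bar>l n\<bar>)"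
    using summable_abs_add[of "c M" "\<lambda>n. l n - c M n"] by simp
  then have Rep: "Rep_ell1 (Abs_ell1 (Abs_fps l)) = Abs_fps l"
    by (simp add: Abs_ell1_inverse)
  have "X \<longlonglongrightarrow> Abs_ell1 (Abs_fps l)"
  proof (rule LIMSEQ_I)
    fix e :: real assume "e > 0"
    then obtain M where M: "\<And>j k. j \<ge> M \<Longrightarrow> k \<ge> M \<Longrightarrow> norm (X j - X k) < e / 2"
      using ex[of "e / 2"] by auto
    have "norm (X j - Abs_ell1 (Abs_fps l)) < e" if "j \<ge> M" for j
      using tail[of j "e / 2"] M that \<open>e > 0\<close>
      by (simp add: norm_ell1.rep_eq minus_ell1.rep_eq Rep c_def)
    then show "\<exists>N. \<forall>j\<ge>N. norm (X j - Abs_ell1 (Abs_fps l)) < e" by blast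
  qed
  then show "convergent X" by (auto simp: convergent_def)
qed

section \<open>Transport to the rescaled algebras\<close>

text \<open>
  For every \<open>r > 0\<close>, rescaling the coefficients by \<open>r ^ n\<close> identifies \<open>A_fps r\<close>
  isometrically with \<open>ell1\<close>, so a single type serves for all radii.
\<close>

definition to_ell1 :: "real \<Rightarrow> real fps \<Rightarrow> ell1" where
  "to_ell1 r F = Abs_ell1 (Abs_fps (\<lambda>n. fps_nth F n * r ^ n))"

text \<open>The scaling is the substitution of \<open>r z\<close> for \<open>z\<close>, which
  respects products since \<open>r ^ n = r ^ i * r ^ (n - i)\<close>.\<close>

lemma abs_fps_mult_scale: "Abs_fps (\<lambda>n. fps_nth (F * G) n * r ^ n) =
    Abs_fps (\<lambda>n. fps_nth F n * r ^ n) * Abs_fps (\<lambda>n. fps_nth G n * r ^ n)"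
  for r :: real
proof (rule fps_ext)
  fix n
  have "(\<Sum>i=0..n. fps_nth F i * fps_nth G (n - i) * r ^ n) =
      (\<Sum>i=0..n. fps_nth F i * r ^ i * (fps_nth G (n - i) * r ^ (n - i)))"
    by (intro sum.cong refl) (simp flip: power_add)
  then show "fps_nth (Abs_fps (\<lambda>n. fps_nth (F * G) n * r ^ n)) n =
      fps_nth (Abs_fps (\<lambda>n. fps_nth F n * r ^ n) * Abs_fps (\<lambda>n. fps_nth G n * r ^ n)) n"
    by (simp add: fps_mult_nth sum_distrib_right)
qed

context
  fixes r :: real
  assumes r: "r > 0"
begin

lemma A_fps_iff: "F \<in> A_fps r \<longleftrightarrow> summable (\<lambda>n. \<bar>fps_nth (Abs_fps (\<lambda>n. fps_nth F n * r ^ n)) n\<bar>)"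
  using r by (simp add: A_fps_def abs_mult)

lemma Rep_to_ell1: "F \<in> A_fps r \<Longrightarrow> Rep_ell1 (to_ell1 r F) = Abs_fps (\<lambda>n. fps_nth F n * r ^ n)"
  unfolding to_ell1_def A_fps_iff by (simp add: Abs_ell1_inverse)

lemma norm_to_ell1: "F \<in> A_fps r \<Longrightarrow> norm (to_ell1 r F) = norm_fps r F"
  using r by (simp add: norm_ell1.rep_eq Rep_to_ell1 norm_fps_def abs_mult)

lemma inj_on_to_ell1: "inj_on (to_ell1 r) (A_fps r)"
proof (rule inj_onI)
  fix F G assume "F \<in> A_fps r" "G \<in> A_fps r" "to_ell1 r F = to_ell1 r G"
  then have "Abs_fps (\<lambda>n. fps_nth F n * r ^ n) = Abs_fps (\<lambda>n. fps_nth G n * r ^ n)"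
    by (metis Rep_to_ell1)
  then show "F = G" using r by (simp add: fps_eq_iff)
qed

text \<open>Pulls elements found in the Banach algebra, in particular the exponent \<open>A\<close>,
  back to power series.\<close>

lemma surj_to_ell1: "\<exists>F\<in>A_fps r. to_ell1 r F = x"
proof
  let ?F = "Abs_fps (\<lambda>n. fps_nth (Rep_ell1 x) n / r ^ n)"
  have F: "Abs_fps (\<lambda>n. fps_nth ?F n * r ^ n) = Rep_ell1 x"
    using r by (simp add: fps_eq_iff)
  show "?F \<in> A_fps r" unfolding A_fps_iff F using Rep_ell1[of x] by simp
  show "to_ell1 r ?F = x" unfolding to_ell1_def F by (rule Rep_ell1_inverse)
qed

lemma A_fps_mult [simp]:
  assumes "F \<in> A_fps r" "G \<in> A_fps r"
  shows "F * G \<in> A_fps r" "to_ell1 r (F * G) = to_ell1 r F * to_ell1 r G"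
proof -
  show FG: "F * G \<in> A_fps r"
    using assms unfolding A_fps_iff abs_fps_mult_scale by (rule summable_abs_fps_mult)
  show "to_ell1 r (F * G) = to_ell1 r F * to_ell1 r G"
    by (rule Rep_ell1_inject[THEN iffD1])
      (simp add: Rep_to_ell1 assms FG times_ell1.rep_eq abs_fps_mult_scale)
qed

lemma A_fps_one [simp]: "1 \<in> A_fps r" "to_ell1 r 1 = 1"
proof -
  have "Abs_fps (\<lambda>n. fps_nth 1 n * r ^ n) = 1" by (simp add: fps_eq_iff)
  then show "1 \<in> A_fps r" "to_ell1 r 1 = 1"
    by (simp_all add: A_fps_iff to_ell1_def one_ell1_def summable_abs_unit del: fps_one_nth)
qed

lemma A_fps_add [simp]:
  assumes "F \<in> A_fps r" "G \<in> A_fps r"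
  shows "F + G \<in> A_fps r" "to_ell1 r (F + G) = to_ell1 r F + to_ell1 r G"
proof -
  show FG: "F + G \<in> A_fps r"
    using assms by (simp add: A_fps_iff distrib_right summable_abs_add)
  show "to_ell1 r (F + G) = to_ell1 r F + to_ell1 r G"
    by (rule Rep_ell1_inject[THEN iffD1])
      (simp add: Rep_to_ell1 assms FG plus_ell1.rep_eq fps_eq_iff distrib_right)
qed

lemma A_fps_const_mult [simp]:
  assumes "F \<in> A_fps r"
  shows "fps_const c * F \<in> A_fps r" "to_ell1 r (fps_const c * F) = c *\<^sub>R to_ell1 r F"
proof -
  show cF: "fps_const c * F \<in> A_fps r"
    using assms by (simp add: A_fps_def abs_mult mult.assoc summable_mult)
  show "to_ell1 r (fps_const c * F) = c *\<^sub>R to_ell1 r F"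
    by (rule Rep_ell1_inject[THEN iffD1])
      (simp add: Rep_to_ell1 assms cF scaleR_ell1.rep_eq fps_eq_iff)
qed

lemma A_fps_diff [simp]:
  assumes "F \<in> A_fps r" "G \<in> A_fps r"
  shows "F - G \<in> A_fps r" "to_ell1 r (F - G) = to_ell1 r F - to_ell1 r G"
proof -
  have eq: "F - G = F + fps_const (-1) * G" by (simp add: fps_eq_iff)
  show "F - G \<in> A_fps r" "to_ell1 r (F - G) = to_ell1 r F - to_ell1 r G"
    unfolding eq using assms by (simp_all del: fps_const_neg)
qed

lemma A_fps_power [simp]:
  assumes "F \<in> A_fps r"
  shows "F ^ k \<in> A_fps r" "to_ell1 r (F ^ k) = to_ell1 r F ^ k"
proof -
  have "F ^ k \<in> A_fps r \<and> to_ell1 r (F ^ k) = to_ell1 r F ^ k"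
    by (induction k) (simp_all add: assms)
  then show "F ^ k \<in> A_fps r" "to_ell1 r (F ^ k) = to_ell1 r F ^ k" by simp_all
qed

lemma A_fps_sum:
  fixes n :: nat
  assumes "\<And>k. F k \<in> A_fps r"
  shows "(\<Sum>k<n. F k) \<in> A_fps r \<and> to_ell1 r (\<Sum>k<n. F k) = (\<Sum>k<n. to_ell1 r (F k))"
proof (induction n)
  case 0
  \<comment> \<open>The empty sum is treated as 0 times the unit.\<close>
  show ?case using A_fps_const_mult[OF A_fps_one(1), of 0] by simp
qed (simp add: assms)

text \<open>On the carrier \<open>to_ell1 r\<close> is a linear isometry, so the norm condition is
  convergence in the topology of \<open>ell1\<close>. The isometry holds for members, which is where
  eventual membership enters.\<close>

lemma norm_tendsto_A_fps_iff:
  "norm_tendsto (A_fps r) (norm_fps r) X L \<F> \<longleftrightarrow>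
    L \<in> A_fps r \<and> (\<forall>\<^sub>F i in \<F>. X i \<in> A_fps r) \<and> ((\<lambda>i. to_ell1 r (X i)) \<longlongrightarrow> to_ell1 r L) \<F>"
proof -
  have "((\<lambda>i. norm_fps r (X i - L)) \<longlongrightarrow> 0) \<F> \<longleftrightarrow>
      ((\<lambda>i. norm (to_ell1 r (X i) - to_ell1 r L)) \<longlongrightarrow> 0) \<F>"
    if "L \<in> A_fps r" "\<forall>\<^sub>F i in \<F>. X i \<in> A_fps r"
    using that(2)
    by (intro filterlim_cong refl, eventually_elim)
       (simp add: norm_to_ell1[symmetric] that(1))
  then show ?thesis
    by (auto simp: norm_tendsto_def tendsto_norm_zero_iff LIM_zero_iff)
qed

text \<open>Limits in \<open>ell1\<close> are unique and \<open>to_ell1 r\<close> is injective on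
  the carrier. This justifies the definite descriptions for the exponential and the
  generator.\<close>

lemma norm_tendsto_A_fps_unique:
  assumes "norm_tendsto (A_fps r) (norm_fps r) X L \<F>" "norm_tendsto (A_fps r) (norm_fps r) X M \<F>"
    and "\<F> \<noteq> bot"
  shows "L = M"
proof -
  have "to_ell1 r L = to_ell1 r M"
    using assms tendsto_unique unfolding norm_tendsto_A_fps_iff by blast
  then show ?thesis
    using assms inj_on_to_ell1 by (auto simp: norm_tendsto_A_fps_iff dest: inj_onD)
qed

text \<open>The partial sums of the exponential series are carried to those of \<open>exp\<close> in
  \<open>ell1\<close>; uniqueness of limits settles the definite description.\<close>

lemma exp_fps_in_eqI:
  assumes "F \<in> A_fps r" "G \<in> A_fps r" "to_ell1 r G = exp (to_ell1 r F)"
  shows "exp_fps_in r F = G"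
proof -
  have "(\<lambda>n. \<Sum>k<n. (1 / fact k) *\<^sub>R to_ell1 r F ^ k) \<longlonglongrightarrow> exp (to_ell1 r F)"
    using exp_converges[of "to_ell1 r F"] by (simp add: sums_def divide_inverse)
  then have *: "norm_tendsto (A_fps r) (norm_fps r) (\<lambda>n. \<Sum>k<n. fps_const (1 / fact k) * F ^ k) G sequentially"
    using A_fps_sum[of "\<lambda>k. fps_const (1 / fact k) * F ^ k"] assms
    by (simp add: norm_tendsto_A_fps_iff)
  show ?thesis
    unfolding exp_fps_in_def
  proof (rule the_equality)
    show "norm_tendsto (A_fps r) (norm_fps r) (\<lambda>n. \<Sum>k<n. fps_const (1 / fact k) * F ^ k) G sequentially"
      by (rule *)
  next
    fix M
    assume "norm_tendsto (A_fps r) (norm_fps r) (\<lambda>n. \<Sum>k<n. fps_const (1 / fact k) * F ^ k) M sequentially"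
    from norm_tendsto_A_fps_unique[OF this *] show "M = G" by simp
  qed
qed

end

section \<open>From sequences under the convolution to power series via \<open>Phi_H\<close>\<close>

lemma A_H_iff: "f \<in> A_H r t \<longleftrightarrow> Phi_H t f \<in> A_fps r"
  by (simp add: A_H_def A_fps_def Phi_H_def)

lemma norm_H_eq: "norm_H r t f = norm_fps r (Phi_H t f)"
  by (simp add: norm_H_def norm_fps_def Phi_H_def)

lemma Phi_H_diff: "Phi_H t (f - g) = Phi_H t f - Phi_H t g"
  by (simp add: Phi_H_def fps_eq_iff diff_divide_distrib)

lemma Phi_H_add: "Phi_H t (\<lambda>n. f n + g n) = Phi_H t f + Phi_H t g"
  by (simp add: Phi_H_def fps_eq_iff add_divide_distrib)

lemma Phi_H_cmult: "Phi_H t (\<lambda>n. c * f n) = fps_const c * Phi_H t f"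
  by (simp add: Phi_H_def fps_eq_iff)

lemma Phi_H_h1: "Phi_H t h1 = 1"
  by (simp add: Phi_H_def fps_eq_iff h1_def falling_def)

lemma Phi_H_diff_quotient:
  "Phi_H t (\<lambda>n. (f n - g n) / s) = fps_const (1 / s) * (Phi_H t f - Phi_H t g)"
  by (simp add: Phi_H_def fps_eq_iff divide_inverse algebra_simps)

lemma norm_tendsto_A_H_iff:
  "norm_tendsto (A_H r t) (norm_H r t) X L \<F> \<longleftrightarrow>
    norm_tendsto (A_fps r) (norm_fps r) (\<lambda>i. Phi_H t (X i)) (Phi_H t L) \<F>"
  by (simp add: norm_tendsto_def A_H_iff norm_H_eq Phi_H_diff)

context
  fixes t :: real
  assumes t: "t \<notin> \<nat>"
begin

text \<open>A factor \<open>t - k\<close> vanishes only for a natural number \<open>t\<close>. Hence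
  division by \<open>falling t n\<close> is reversible, which makes \<open>Phi_H\<close>
  bijective.\<close>

lemma falling_nonzero: "falling t n \<noteq> 0"
  using t by (auto simp: falling_def)

lemma Phi_H_inj: "Phi_H t f = Phi_H t g \<longleftrightarrow> f = g"
  by (auto simp: Phi_H_def fps_eq_iff falling_nonzero)

lemma Phi_H_surj: "\<exists>f. Phi_H t f = F"
  by (rule exI[of _ "\<lambda>n. fps_nth F n * falling t n"])
    (simp add: Phi_H_def fps_eq_iff falling_nonzero)

text \<open>The numerator \<open>falling t n\<close> of the weight cancels against the denominator
  in \<open>Phi_H\<close>, and the other two factors normalise \<open>f\<close> and
  \<open>g\<close>.\<close>

lemma Phi_H_conv: "Phi_H t (conv_H t f g) = Phi_H t f * Phi_H t g"
  by (simp add: Phi_H_def conv_H_def fps_eq_iff fps_mult_nth atLeast0AtMost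
      sum_divide_distrib falling_nonzero cong: sum.cong_simp)

text \<open>Linearity and the bound \<open>norm_fps r G\<close> are those of multiplication by
  \<open>G\<close>, carried back through \<open>Phi_H\<close>. It serves both the semigroup
  operators, with \<open>G = Phi_H t (q s)\<close>, and the generator.\<close>

lemma bounded_operator_HI:
  assumes r: "r > 0" and G: "G \<in> A_fps r"
    and T: "\<And>f. f \<in> A_H r t \<Longrightarrow> Phi_H t (T f) = G * Phi_H t f"
  shows "bounded_operator_H r t T"
  unfolding bounded_operator_H_def
proof (intro conjI ballI allI)
  fix f g c assume f: "f \<in> A_H r t"
  show "T f \<in> A_H r t" using f T G r by (simp add: A_H_iff)
  have cf: "(\<lambda>n. c * f n) \<in> A_H r t"
    using f r by (simp add: A_H_iff Phi_H_cmult)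
  show "T (\<lambda>n. c * f n) = (\<lambda>n. c * T f n)"
    unfolding Phi_H_inj[symmetric] Phi_H_cmult T[OF f] T[OF cf] by (simp add: mult.left_commute)
  assume g: "g \<in> A_H r t"
  have fg: "(\<lambda>n. f n + g n) \<in> A_H r t"
    using f g r by (simp add: A_H_iff Phi_H_add)
  show "T (\<lambda>n. f n + g n) = (\<lambda>n. T f n + T g n)"
    unfolding Phi_H_inj[symmetric] Phi_H_add T[OF f] T[OF g] T[OF fg] by (simp add: distrib_left)
next
  show "\<exists>C. \<forall>f\<in>A_H r t. norm_H r t (T f) \<le> C * norm_H r t f"
  proof (intro exI ballI)
    fix f assume f: "f \<in> A_H r t"
    then show "norm_H r t (T f) \<le> norm_fps r G * norm_H r t f"
      using norm_mult_ineq[of "to_ell1 r G" "to_ell1 r (Phi_H t f)"] G r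
      by (simp add: norm_H_eq T norm_to_ell1[symmetric] A_H_iff)
  qed
qed

end

section \<open>The exponent and the generator of the convolution semigroup\<close>

theorem theorem5p3:
  fixes t r :: real and q :: "real \<Rightarrow> nat \<Rightarrow> real"
  assumes "t \<notin> \<nat>" and "r > 0" and "norm_cont_semigroup_H r t q"
  shows "\<exists>\<eta>.
     norm_tendsto (A_fps r) (norm_fps r) (\<lambda>s. fps_const (1 / s) * (Phi_H t (q s) - 1)) \<eta> (at_right 0) \<and>
     (\<forall>s\<ge>0. Phi_H t (q s) = exp_fps_in r (fps_const s * \<eta>)) \<and>
     operator_semigroup_H r t (conv_operator_H t q) \<and>
     generator_dom_H r t (conv_operator_H t q) = A_H r t \<and>
     bounded_operator_H r t (generator_H r t (conv_operator_H t q)) \<and>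
     (\<forall>f\<in>A_H r t. generator_H r t (conv_operator_H t q) f =
        (inv_into (A_H r t) (Phi_H t) \<circ> mult_operator \<eta> \<circ> Phi_H t) f) \<and>
     (\<forall>f\<in>A_H r t. norm_tendsto (A_H r t) (norm_H r t)
        (\<lambda>s n. (conv_H t f (q s) n - f n) / s)
        (generator_H r t (conv_operator_H t q) f) (at_right 0))"
proof -
  note t = \<open>t \<notin> \<nat>\<close> and r [simp] = \<open>r > 0\<close>
  note [simp] = Phi_H_conv[OF t]
  let ?T = "conv_operator_H t q"
  define P where "P s = to_ell1 r (Phi_H t (q s))" for s
  have q: "\<And>s. s \<ge> 0 \<Longrightarrow> Phi_H t (q s) \<in> A_fps r"
    and q0: "q 0 = h1"
    and q_add: "\<And>s u. s \<ge> 0 \<Longrightarrow> u \<ge> 0 \<Longrightarrow> q (s + u) = conv_H t (q s) (q u)"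
    and q_lim: "((\<lambda>s. norm_H r t (q s - h1)) \<longlongrightarrow> 0) (at_right 0)"
    using assms(3) by (simp_all add: norm_cont_semigroup_H_def A_H_iff)
  have pos: "\<forall>\<^sub>F s in at_right 0. s > (0::real)"
    by (rule eventually_at_right_less)
  have "\<forall>\<^sub>F s in at_right 0. q s \<in> A_H r t"
    using pos by eventually_elim (simp add: A_H_iff q)
  with q_lim have "norm_tendsto (A_H r t) (norm_H r t) q h1 (at_right 0)"
    by (simp add: norm_tendsto_def A_H_iff Phi_H_h1)
  then have P_lim: "(P \<longlongrightarrow> 1) (at_right 0)"
    by (simp add: norm_tendsto_A_H_iff norm_tendsto_A_fps_iff Phi_H_h1 P_def[abs_def])
  have "\<exists>A. \<forall>s\<ge>0. P s = exp (s *\<^sub>R A)"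
  proof (rule norm_continuous_semigroup_eq_exp[OF _ _ P_lim])
    show "P 0 = 1" by (simp add: P_def q0 Phi_H_h1)
    show "P (s + u) = P s * P u" if "s \<ge> 0" "u \<ge> 0" for s u
      using that by (simp add: P_def q_add q)
  qed
  \<comment> \<open>\<open>\<eta>\<close> is the power series whose image in \<open>ell1\<close> is
    the exponent \<open>A\<close>.\<close>
  then obtain \<eta> where \<eta> [simp]: "\<eta> \<in> A_fps r" and P_exp: "\<And>s. s \<ge> 0 \<Longrightarrow> P s = exp (s *\<^sub>R to_ell1 r \<eta>)"
    by (metis surj_to_ell1[OF r])
  have quot_lim: "((\<lambda>s. (P s - 1) /\<^sub>R s) \<longlongrightarrow> to_ell1 r \<eta>) (at_right 0)"
    by (rule Lim_transform_eventually[OF exp_scaleR_diff_quotient])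
      (use pos in eventually_elim, simp add: P_exp)
  \<comment> \<open>An equivalence is proved because it yields both existence of the generator limit
    for every \<open>f\<close> and its value: one direction is continuity of the product, the other
    uniqueness of limits.\<close>
  have lim: "generator_lim_H r t ?T f g \<longleftrightarrow> Phi_H t g = \<eta> * Phi_H t f"
    if f: "f \<in> A_H r t" for f g
  proof -
    let ?D = "\<lambda>s n. (?T s f n - f n) / s"
    \<comment> \<open>After transport the difference quotient is \<open>(P s - 1) / s\<close> times
      an element independent of \<open>s\<close>.\<close>
    have D: "Phi_H t (?D s) \<in> A_fps r \<and>
        to_ell1 r (Phi_H t (?D s)) = (P s - 1) /\<^sub>R s * to_ell1 r (Phi_H t f)" if "s > 0" for s
      using that f q[of s]
      unfolding Phi_H_diff_quotient conv_operator_H_def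
      by (simp add: A_H_iff P_def) (simp add: algebra_simps divide_inverse)
    have "((\<lambda>s. to_ell1 r (Phi_H t (?D s))) \<longlongrightarrow> to_ell1 r \<eta> * to_ell1 r (Phi_H t f)) (at_right 0)"
      by (rule Lim_transform_eventually[OF tendsto_mult[OF quot_lim tendsto_const]])
        (use pos in eventually_elim, simp add: D)
    moreover have "\<forall>\<^sub>F s in at_right 0. Phi_H t (?D s) \<in> A_fps r"
      using pos by eventually_elim (simp add: D)
    ultimately have *: "norm_tendsto (A_fps r) (norm_fps r) (\<lambda>s. Phi_H t (?D s)) (\<eta> * Phi_H t f) (at_right 0)"
      using f by (simp add: norm_tendsto_A_fps_iff A_H_iff)
    show ?thesis
      unfolding generator_lim_H_def norm_tendsto_A_H_iff
    proof
      assume "norm_tendsto (A_fps r) (norm_fps r) (\<lambda>s. Phi_H t (?D s)) (Phi_H t g) (at_right 0)"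
      from norm_tendsto_A_fps_unique[OF r this *] show "Phi_H t g = \<eta> * Phi_H t f" by simp
    next
      assume eq: "Phi_H t g = \<eta> * Phi_H t f"
      show "norm_tendsto (A_fps r) (norm_fps r) (\<lambda>s. Phi_H t (?D s)) (Phi_H t g) (at_right 0)"
        unfolding eq by (rule *)
    qed
  qed
  \<comment> \<open>Surjectivity of \<open>Phi_H\<close> supplies the limit and injectivity its
    uniqueness, so the definite description is resolved.\<close>
  have gen: "generator_lim_H r t ?T f (generator_H r t ?T f)" if "f \<in> A_H r t" for f
  proof -
    obtain g where g: "Phi_H t g = \<eta> * Phi_H t f"
      using Phi_H_surj[OF t] by blast
    show ?thesis
      unfolding generator_H_def
    proof (rule theI[of "generator_lim_H r t ?T f"])
      show "generator_lim_H r t ?T f g" using g lim[OF that] by simp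
      show "h = g" if "generator_lim_H r t ?T f h" for h
        using that g lim[OF \<open>f \<in> A_H r t\<close>, of h] Phi_H_inj[OF t, of h g] by simp
    qed
  qed
  then have Phi_gen: "Phi_H t (generator_H r t ?T f) = \<eta> * Phi_H t f" if "f \<in> A_H r t" for f
    using that lim by blast
  show ?thesis
  proof (intro exI[of _ \<eta>] conjI allI impI ballI)
    show "norm_tendsto (A_fps r) (norm_fps r) (\<lambda>s. fps_const (1 / s) * (Phi_H t (q s) - 1)) \<eta> (at_right 0)"
      unfolding norm_tendsto_A_fps_iff[OF r]
    proof (intro conjI \<eta>)
      show "\<forall>\<^sub>F s in at_right 0. fps_const (1 / s) * (Phi_H t (q s) - 1) \<in> A_fps r"
        using pos by eventually_elim (simp add: q)
      show "((\<lambda>s. to_ell1 r (fps_const (1 / s) * (Phi_H t (q s) - 1))) \<longlongrightarrow> to_ell1 r \<eta>) (at_right 0)"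
        by (rule Lim_transform_eventually[OF quot_lim])
          (use pos in eventually_elim, simp add: q P_def divide_inverse)
    qed
    show "Phi_H t (q s) = exp_fps_in r (fps_const s * \<eta>)" if "s \<ge> 0" for s
      using that P_exp[of s] by (intro exp_fps_in_eqI[OF r, symmetric]) (simp_all add: q P_def)
    show "operator_semigroup_H r t ?T"
      unfolding operator_semigroup_H_def
    proof (intro conjI allI impI ballI)
      show "bounded_operator_H r t (?T s)" if "s \<ge> 0" for s
        using q[OF that] by (rule bounded_operator_HI[OF t r]) (simp add: conv_operator_H_def mult.commute)
      fix f assume f: "f \<in> A_H r t"
      show "?T 0 f = f"
        by (simp add: Phi_H_inj[OF t, symmetric] conv_operator_H_def q0 Phi_H_h1)
      show "?T (s + u) f = ?T s (?T u f)" if "s \<ge> 0" "u \<ge> 0" for s u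
        by (simp add: Phi_H_inj[OF t, symmetric] conv_operator_H_def q_add that mult_ac)
      \<comment> \<open>Strong continuity follows from \<open>P s\<close> tending to 1 and
        continuity of multiplication.\<close>
      have "((\<lambda>s. to_ell1 r (Phi_H t (?T s f))) \<longlongrightarrow> to_ell1 r (Phi_H t f) * 1) (at_right 0)"
        by (rule Lim_transform_eventually[OF tendsto_mult[OF tendsto_const P_lim]])
          (use pos in eventually_elim, use f in \<open>simp add: conv_operator_H_def P_def q A_H_iff\<close>)
      moreover have "\<forall>\<^sub>F s in at_right 0. Phi_H t (?T s f) \<in> A_fps r"
        using pos by eventually_elim (use f in \<open>simp add: conv_operator_H_def q A_H_iff\<close>)
      ultimately show "norm_tendsto (A_H r t) (norm_H r t) (\<lambda>s. ?T s f) f (at_right 0)"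
        using f by (simp add: norm_tendsto_A_H_iff norm_tendsto_A_fps_iff A_H_iff)
    qed
    show "generator_dom_H r t ?T = A_H r t"
      using gen by (auto simp: generator_dom_H_def)
    show "bounded_operator_H r t (generator_H r t ?T)"
      by (rule bounded_operator_HI[OF t r \<eta> Phi_gen])
    fix f assume f: "f \<in> A_H r t"
    show "generator_H r t ?T f = (inv_into (A_H r t) (Phi_H t) \<circ> mult_operator \<eta> \<circ> Phi_H t) f"
    \<comment> \<open>\<open>inv_into\<close> undoes \<open>Phi_H\<close> at images of members of
      \<open>A_H r t\<close>, so membership of the generator's value is shown first.\<close>
    proof -
      have "generator_H r t ?T f \<in> A_H r t"
        using gen[OF f] by (simp add: generator_lim_H_def norm_tendsto_def)
      moreover have "inj_on (Phi_H t) (A_H r t)"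
        by (simp add: inj_on_def Phi_H_inj[OF t])
      ultimately show ?thesis
        by (simp add: mult_operator_def Phi_gen[OF f, symmetric])
    qed
    show "norm_tendsto (A_H r t) (norm_H r t) (\<lambda>s n. (conv_H t f (q s) n - f n) / s)
        (generator_H r t ?T f) (at_right 0)"
      using gen[OF f] by (simp add: generator_lim_H_def conv_operator_H_def)
  qed
qed

end
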